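(* Let $A\in\mathbb{R}^{m\times n}$ with $m<n$, $\boldsymbol b\in\mathbb{R}^m$ with $\boldsymbol b\neq\mathbf 0$, $\alpha>0$, $\mu>0$, and let $$\mathcal G_\mu(\boldsymbol x)=\tfrac{\alpha}{2}\|A\boldsymbol x-\boldsymbol b\|_2^2+\Phi_\mu(\boldsymbol x),\qquad \boldsymbol x\in\mathbb{R}^n.$$ Then, for any optimal solution $\widehat{\boldsymbol x}\in\mathbb{R}^n$ of $\min_{\boldsymbol x\in\mathbb{R}^n}\mathcal G_\mu(\boldsymbol x)$, the function $\mathcal G_\mu$ is differentiable in a neighborhood of $\widehat{\boldsymbol x}$, and furthermore $|\widehat{\boldsymbol x}_i|\neq\mu$ for all $i=1,\dots,n$.
   Context: The truncated Huber function with parameter $\mu>0$ is $\phi_\mu(x)=\min(1,x^2/\mu^2)$ for $x\in\mathbb{R}$, and $\Phi_\mu(\boldsymbol x)=\sum_{i=1}^n\phi_\mu(\boldsymbol x_i)$ for $\boldsymbol x\in\mathbb{R}^n$. *)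

theory Defs
  imports "HOL-Analysis.Analysis"
begin

definition trunc_huber :: "real \<Rightarrow> real \<Rightarrow> real" where
  "trunc_huber \<mu> t = min 1 (t\<^sup>2 / \<mu>\<^sup>2)"

definition trunc_huber_sum :: "real \<Rightarrow> real ^ 'n \<Rightarrow> real" where
  "trunc_huber_sum \<mu> x = (\<Sum>i\<in>UNIV. trunc_huber \<mu> (x $ i))"

text \<open>On \<open>real ^ 'm\<close> the library norm is the Euclidean norm.\<close>

definition huber_objective ::
    "real ^ 'n ^ 'm \<Rightarrow> real ^ 'm \<Rightarrow> real \<Rightarrow> real \<Rightarrow> real ^ 'n \<Rightarrow> real" where
  "huber_objective A b \<alpha> \<mu> x = \<alpha> / 2 * (norm (A *v x - b))\<^sup>2 + trunc_huber_sum \<mu> x"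

end

theory Submission
  imports Defs
begin

text \<open>The quadratic term is smooth, and \<open>trunc_huber \<mu>\<close> fails to be differentiable only at \<open>\<plusminus>\<mu>\<close>,
  where it has a concave kink: its slope drops from \<open>2/\<mu>\<close> to \<open>0\<close> as \<open>\<bar>t\<bar>\<close> increases through \<open>\<mu>\<close>.
  Adding a smooth function to a concave kink never produces a minimum, so no coordinate of a
  minimizer has modulus \<open>\<mu>\<close>. The points with this property form an open set, on which the
  objective is differentiable.

  The kink argument is carried out with symmetric second differences along a coordinate axis
  instead of one-sided derivatives. By the parallelogram law the quadratic term contributes
  exactly \<open>\<alpha> h\<^sup>2 \<parallel>A e\<^sub>i\<parallel>\<^sup>2\<close>, while the kink contributes \<open>- 2 h / \<mu> + h\<^sup>2 / \<mu>\<^sup>2\<close>. For small \<open>h > 0\<close>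
  the negative term of first order wins, whereas at a minimizer every second difference is
  nonnegative.\<close>

lemma trunc_huber_differentiable:
  assumes "\<mu> > 0" and "\<bar>t\<bar> \<noteq> \<mu>"
  shows "trunc_huber \<mu> differentiable (at t)"
proof (cases "\<bar>t\<bar> < \<mu>")
  case True
  have sq: "(\<lambda>s::real. s\<^sup>2 / \<mu>\<^sup>2) differentiable (at t)"
    by (intro derivative_intros) (use assms in auto)
  have "trunc_huber \<mu> s = s\<^sup>2 / \<mu>\<^sup>2" if "s \<in> {-\<mu><..<\<mu>}" for s
  proof -
    have "s\<^sup>2 \<le> \<mu>\<^sup>2"
      using that assms(1) by (intro abs_le_square_iff[THEN iffD1]) auto
    then show ?thesis
      using assms(1) by (simp add: trunc_huber_def min_def divide_simps)
  qed
  then show ?thesis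
    using sq True unfolding differentiable_def
    by (metis (no_types, lifting) has_derivative_transform_within_open
        open_greaterThanLessThan abs_less_iff greaterThanLessThan_iff minus_less_iff)
next
  case False
  let ?S = "{s::real. \<mu> < \<bar>s\<bar>}"
  have "trunc_huber \<mu> s = 1" if "s \<in> ?S" for s
  proof -
    have "\<mu>\<^sup>2 \<le> s\<^sup>2"
      using that assms(1) by (intro abs_le_square_iff[THEN iffD1]) auto
    then show ?thesis
      using assms(1) by (simp add: trunc_huber_def min_def divide_simps)
  qed
  moreover have "open ?S"
    by (intro open_Collect_less continuous_intros)
  moreover have "t \<in> ?S"
    using False assms(2) by simp
  ultimately show ?thesis
    unfolding differentiable_def
    by (metis (no_types, lifting) has_derivative_transform_within_open has_derivative_const)
qed

lemma huber_objective_differentiable: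
  assumes "\<mu> > 0" and "\<forall>i. \<bar>y $ i\<bar> \<noteq> \<mu>"
  shows "huber_objective A b \<alpha> \<mu> differentiable (at y)"
proof -
  have lin: "(\<lambda>x. A *v x - b) differentiable (at y)"
    by (intro differentiable_diff linear_imp_differentiable matrix_vector_mul_linear
        differentiable_const)
  have quad: "(\<lambda>x. \<alpha> / 2 * (norm (A *v x - b))\<^sup>2) differentiable (at y)"
    unfolding power2_norm_eq_inner using lin
    by (intro differentiable_mult differentiable_inner differentiable_const)
  have "(\<lambda>x. trunc_huber \<mu> (x $ i)) differentiable (at y)" for i
  proof -
    have "(trunc_huber \<mu> \<circ> (\<lambda>x. x $ i)) differentiable (at y)"
      by (intro differentiable_chain_at linear_imp_differentiable
          bounded_linear.linear bounded_linear_vec_nth trunc_huber_differentiable)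
        (use assms in auto)
    then show ?thesis
      by (simp add: o_def)
  qed
  then have "trunc_huber_sum \<mu> differentiable (at y)"
    unfolding trunc_huber_sum_def by (intro differentiable_sum) auto
  then show ?thesis
    using quad unfolding huber_objective_def by (intro differentiable_add) auto
qed

text \<open>The sign of the kink's location is irrelevant: moving both ways from \<open>\<plusminus>\<mu>\<close>, one end point
  lands on the plateau, where the value stays \<open>1\<close>, and the other on the parabola.\<close>

lemma trunc_huber_second_difference_at_kink:
  assumes "\<bar>t\<bar> = \<mu>" and "0 < h" and "h \<le> \<mu>"
  shows "trunc_huber \<mu> (t + h) + trunc_huber \<mu> (t - h) - 2 * trunc_huber \<mu> t
    = h\<^sup>2 / \<mu>\<^sup>2 - 2 * h / \<mu>"
proof -
  have pos: "\<mu> > 0"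
    using assms by linarith
  have even: "trunc_huber \<mu> (- s) = trunc_huber \<mu> s" for s
    by (simp add: trunc_huber_def)
  have kink: "trunc_huber \<mu> \<mu> = 1"
    using pos by (simp add: trunc_huber_def)
  have "\<mu>\<^sup>2 \<le> (\<mu> + h)\<^sup>2" and le: "(\<mu> - h)\<^sup>2 \<le> \<mu>\<^sup>2"
    using assms pos by (auto intro!: power_mono)
  then have plateau: "trunc_huber \<mu> (\<mu> + h) = 1"
    using pos by (simp add: trunc_huber_def min_def divide_simps)
  have "trunc_huber \<mu> (\<mu> - h) = (\<mu> - h)\<^sup>2 / \<mu>\<^sup>2"
    using le pos by (simp add: trunc_huber_def min_def divide_simps)
  also have "\<dots> = 1 + h\<^sup>2 / \<mu>\<^sup>2 - 2 * h / \<mu>"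
    using pos by (simp add: field_simps power2_eq_square)
  finally have parabola: "trunc_huber \<mu> (\<mu> - h) = 1 + h\<^sup>2 / \<mu>\<^sup>2 - 2 * h / \<mu>" .
  consider "t = \<mu>" | "t = - \<mu>"
    using assms(1) by linarith
  then show ?thesis
  proof cases
    case 1
    then show ?thesis
      using kink plateau parabola by simp
  next
    case 2
    then show ?thesis
      using kink plateau parabola even[of \<mu>] even[of "\<mu> + h"] even[of "\<mu> - h"]
      by (simp add: algebra_simps)
  qed
qed

text \<open>Only the \<open>i\<close>-th summand of \<open>trunc_huber_sum\<close> sees a move along the \<open>i\<close>-th axis, and the
  parallelogram law makes the contribution of the quadratic term independent of \<open>x\<close> and \<open>b\<close>.\<close>

lemma huber_objective_second_difference:
  shows "huber_objective A b \<alpha> \<mu> (x + axis i h) + huber_objective A b \<alpha> \<mu> (x - axis i h)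
      - 2 * huber_objective A b \<alpha> \<mu> x
    = \<alpha> * h\<^sup>2 * (norm (A *v axis i 1))\<^sup>2
      + (trunc_huber \<mu> (x $ i + h) + trunc_huber \<mu> (x $ i - h) - 2 * trunc_huber \<mu> (x $ i))"
proof -
  let ?r = "A *v x - b" and ?v = "A *v axis i h"
  have par: "(norm (?r + ?v))\<^sup>2 + (norm (?r - ?v))\<^sup>2 = 2 * (norm ?r)\<^sup>2 + 2 * (norm ?v)\<^sup>2"
    by (simp add: power2_norm_eq_inner inner_simps inner_commute)
  have ends: "A *v (x + axis i h) - b = ?r + ?v" "A *v (x - axis i h) - b = ?r - ?v"
    by (simp_all add: matrix_vector_right_distrib matrix_vector_mult_diff_distrib)
  have scale: "(norm ?v)\<^sup>2 = h\<^sup>2 * (norm (A *v axis i 1))\<^sup>2"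
  proof -
    have "axis i h = h *\<^sub>R axis i (1::real)"
      by (simp add: vec_eq_iff axis_def)
    then show ?thesis
      by (simp add: matrix_vector_mult_scaleR power_mult_distrib)
  qed
  have "\<alpha> / 2 * (norm (?r + ?v))\<^sup>2 + \<alpha> / 2 * (norm (?r - ?v))\<^sup>2 - 2 * (\<alpha> / 2 * (norm ?r)\<^sup>2)
      = \<alpha> / 2 * ((norm (?r + ?v))\<^sup>2 + (norm (?r - ?v))\<^sup>2 - 2 * (norm ?r)\<^sup>2)"
    by (simp only: distrib_left right_diff_distrib mult.left_commute)
  also have "\<dots> = \<alpha> * h\<^sup>2 * (norm (A *v axis i 1))\<^sup>2"
    unfolding par scale by simp
  finally have quad: "\<alpha> / 2 * (norm (A *v (x + axis i h) - b))\<^sup>2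
      + \<alpha> / 2 * (norm (A *v (x - axis i h) - b))\<^sup>2 - 2 * (\<alpha> / 2 * (norm ?r)\<^sup>2)
      = \<alpha> * h\<^sup>2 * (norm (A *v axis i 1))\<^sup>2"
    unfolding ends .
  let ?D = "\<lambda>j. trunc_huber \<mu> ((x + axis i h) $ j) + trunc_huber \<mu> ((x - axis i h) $ j)
      - 2 * trunc_huber \<mu> (x $ j)"
  have "trunc_huber_sum \<mu> (x + axis i h) + trunc_huber_sum \<mu> (x - axis i h)
      - 2 * trunc_huber_sum \<mu> x = (\<Sum>j\<in>UNIV. ?D j)"
    by (simp add: trunc_huber_sum_def sum.distrib sum_subtractf sum_distrib_left)
  also have "\<dots> = (\<Sum>j\<in>{i}. ?D j)"
    by (rule sum.mono_neutral_right) (auto simp: axis_def)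
  also have "\<dots> = trunc_huber \<mu> (x $ i + h) + trunc_huber \<mu> (x $ i - h) - 2 * trunc_huber \<mu> (x $ i)"
    by (simp add: axis_def)
  finally show ?thesis
    using quad unfolding huber_objective_def by (simp add: algebra_simps)
qed

lemma huber_minimizer_avoids_kinks:
  assumes "\<alpha> > 0" and "\<mu> > 0"
    and min: "\<forall>x. huber_objective A b \<alpha> \<mu> xhat \<le> huber_objective A b \<alpha> \<mu> x"
  shows "\<bar>xhat $ i\<bar> \<noteq> \<mu>"
proof
  assume kink: "\<bar>xhat $ i\<bar> = \<mu>"
  define c where "c = \<alpha> * (norm (A *v axis i 1))\<^sup>2 + 1 / \<mu>\<^sup>2"
  \<comment> \<open>The second difference is \<open>c * h\<^sup>2 - 2 * h / \<mu>\<close>; this \<open>h\<close> minimizes it.\<close>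
  define h where "h = 1 / (c * \<mu>)"
  have c_ge: "c \<ge> 1 / \<mu>\<^sup>2"
    using assms(1) by (simp add: c_def)
  have "c > 0"
    using less_le_trans[OF _ c_ge] assms(2) by simp
  then have h_pos: "h > 0"
    using assms(2) by (simp add: h_def)
  \<comment> \<open>The inner end point has to stay between the two kinks.\<close>
  have h_le: "h \<le> \<mu>"
    using c_ge \<open>c > 0\<close> assms(2) by (simp add: h_def field_simps power2_eq_square)
  have "0 \<le> huber_objective A b \<alpha> \<mu> (xhat + axis i h) + huber_objective A b \<alpha> \<mu> (xhat - axis i h)
      - 2 * huber_objective A b \<alpha> \<mu> xhat"
    using min[rule_format, of "xhat + axis i h"] min[rule_format, of "xhat - axis i h"] by linarith
  also have "\<dots> = \<alpha> * h\<^sup>2 * (norm (A *v axis i 1))\<^sup>2 + (h\<^sup>2 / \<mu>\<^sup>2 - 2 * h / \<mu>)"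
    unfolding huber_objective_second_difference
      trunc_huber_second_difference_at_kink[OF kink h_pos h_le] ..
  also have "\<dots> = h * (c * h) - 2 * h / \<mu>"
    by (simp add: c_def algebra_simps power2_eq_square)
  also have "c * h = 1 / \<mu>"
    using \<open>c > 0\<close> by (simp add: h_def)
  also have "h * (1 / \<mu>) - 2 * h / \<mu> = - (h / \<mu>)"
    by simp
  finally show False
    using divide_pos_pos[OF h_pos assms(2)] by linarith
qed

theorem theorem2p6:
  fixes A :: "real ^ 'n ^ 'm" and b :: "real ^ 'm" and \<alpha> \<mu> :: real and xhat :: "real ^ 'n"
  assumes "CARD('m) < CARD('n)"
    and "b \<noteq> 0"
    and "\<alpha> > 0"
    and "\<mu> > 0"
    and "\<forall>x. huber_objective A b \<alpha> \<mu> xhat \<le> huber_objective A b \<alpha> \<mu> x"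
  shows "(\<exists>U. open U \<and> xhat \<in> U \<and> (\<forall>y\<in>U. huber_objective A b \<alpha> \<mu> differentiable (at y)))
    \<and> (\<forall>i. \<bar>xhat $ i\<bar> \<noteq> \<mu>)"
proof -
  have avoid: "\<forall>i. \<bar>xhat $ i\<bar> \<noteq> \<mu>"
    using huber_minimizer_avoids_kinks[OF assms(3-5)] by blast
  let ?U = "{y :: real ^ 'n. \<forall>i. \<bar>y $ i\<bar> \<noteq> \<mu>}"
  have "open (\<Inter>i. {y :: real ^ 'n. \<bar>y $ i\<bar> \<noteq> \<mu>})"
    by (intro open_INT ballI open_Collect_neq continuous_intros finite_class.finite_UNIV)
  then have "open ?U"
    by (simp add: INT_iff Collect_all_eq)
  moreover have "\<forall>y\<in>?U. huber_objective A b \<alpha> \<mu> differentiable (at y)"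
    using huber_objective_differentiable[OF assms(4)] by blast
  ultimately show ?thesis
    using avoid by blast
qed

end
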